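(* Let $\rho_0$ and $\rho_1$ be quantum states on a common finite-dimensional Hilbert space. (1) For every $\alpha\in[1,\infty)$, $$2^{1-\frac1\alpha}\,\mathrm{T}_\alpha(\rho_0,\rho_1)\le \mathrm{T}(\rho_0,\rho_1)\le 2\big(\mathrm{rank}(\rho_0)^{1-\alpha}+\mathrm{rank}(\rho_1)^{1-\alpha}\big)^{-\frac1\alpha}\,\mathrm{T}_\alpha(\rho_0,\rho_1),$$ and for $\alpha=\infty$ the inequalities hold in the limit $\alpha\to\infty$, i.e. $$2\,\mathrm{T}_\infty(\rho_0,\rho_1)\le \mathrm{T}(\rho_0,\rho_1)\le 2\min\{\mathrm{rank}(\rho_0),\mathrm{rank}(\rho_1)\}\,\mathrm{T}_\infty(\rho_0,\rho_1).$$ (2) For every $\alpha\in(0,1)$, $$\mathrm{T}(\rho_0,\rho_1)^\alpha\le \Lambda_\alpha(\rho_0,\rho_1)\le \frac{\mathrm{rank}(\rho_0)^{1-\alpha}+\mathrm{rank}(\rho_1)^{1-\alpha}}{2}\,\mathrm{T}(\rho_0,\rho_1)^\alpha.$$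
   Context: A quantum state is a positive semi-definite matrix of trace one. $|A|=(A^\dagger A)^{1/2}$. $\mathrm{T}(\rho_0,\rho_1)=\frac12\mathrm{tr}|\rho_0-\rho_1|$ is the trace distance. For finite $\alpha>0$, $\mathrm{T}_\alpha(\rho_0,\rho_1)=\frac12\big(\mathrm{tr}(|\rho_0-\rho_1|^\alpha)\big)^{1/\alpha}$ and $\Lambda_\alpha(\rho_0,\rho_1)=\frac12\mathrm{tr}(|\rho_0-\rho_1|^\alpha)$ (with $|A|^\alpha$ taken to be zero on the kernel of $A$). $\mathrm{T}_\infty(\rho_0,\rho_1)=\frac12\|\rho_0-\rho_1\|$, with $\|\cdot\|$ the operator norm. *)

theory Defs
  imports "HOL-Analysis.Analysis"
begin

text \<open>Operators on a Hilbert space of finite dimension \<open>CARD('n)\<close> are square complex matrices.\<close>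

definition adj :: "complex^'n^'m \<Rightarrow> complex^'m^'n" where
  "adj A = (\<chi> i j. cnj (A $ j $ i))"

definition unitary :: "complex^'n^'n \<Rightarrow> bool" where
  "unitary U \<longleftrightarrow> adj U ** U = mat 1 \<and> U ** adj U = mat 1"

definition diag :: "('n \<Rightarrow> real) \<Rightarrow> complex^'n^'n" where
  "diag d = (\<chi> i j. if i = j then complex_of_real (d i) else 0)"

text \<open>For Hermitian \<open>A\<close> the quadratic form is real-valued, so taking \<open>Re\<close> loses nothing.\<close>

definition psd :: "complex^'n^'n \<Rightarrow> bool" where
  "psd A \<longleftrightarrow> adj A = A \<and> (\<forall>x. 0 \<le> Re (\<Sum>i\<in>UNIV. cnj (x $ i) * (A *v x) $ i))"

definition quantum_state :: "complex^'n^'n \<Rightarrow> bool" where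
  "quantum_state \<rho> \<longleftrightarrow> psd \<rho> \<and> trace \<rho> = 1"

text \<open>
  Functional calculus: if \<open>P = U diag(d) U\<^sup>\<dagger>\<close> is a spectral decomposition of a positive
  semi-definite \<open>P\<close>, then \<open>P\<^sup>a = U diag(d\<^sup>a) U\<^sup>\<dagger>\<close>. Since \<open>0 powr a = 0\<close> for every \<open>a\<close>,
  the power vanishes on the kernel of \<open>P\<close>. By the lemma \<open>is_mat_powr_unique\<close> below, the result
  does not depend on the chosen decomposition.
\<close>

definition is_mat_powr :: "complex^'n^'n \<Rightarrow> real \<Rightarrow> complex^'n^'n \<Rightarrow> bool" where
  "is_mat_powr P a M \<longleftrightarrow>
     (\<exists>U d. unitary U \<and> (\<forall>i. 0 \<le> d i) \<and> P = U ** diag d ** adj U \<and>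
            M = U ** diag (\<lambda>i. d i powr a) ** adj U)"

lemma diag_mult_left: "(diag d ** A) $ i $ j = complex_of_real (d i) * A $ i $ j"
  by (simp add: diag_def matrix_matrix_mult_def if_distrib [where f = "\<lambda>x. x * _"] cong: if_cong)

lemma diag_mult_right: "(A ** diag d) $ i $ j = A $ i $ j * complex_of_real (d j)"
  by (simp add: diag_def matrix_matrix_mult_def if_distrib [where f = "\<lambda>x. _ * x"] cong: if_cong)

lemma is_mat_powr_unique:
  assumes "is_mat_powr P a M" "is_mat_powr P a N"
  shows "M = N"
proof -
  obtain U d where U: "unitary U" "P = U ** diag d ** adj U"
    "M = U ** diag (\<lambda>i. d i powr a) ** adj U"
    using assms(1) unfolding is_mat_powr_def by blast
  obtain V e where V: "unitary V" "P = V ** diag e ** adj V"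
    "N = V ** diag (\<lambda>i. e i powr a) ** adj V"
    using assms(2) unfolding is_mat_powr_def by blast
  note un = U(1)[unfolded unitary_def] V(1)[unfolded unitary_def]
  define W where "W = adj V ** U"
  have "adj V ** P ** U = W ** diag d ** (adj U ** U)"
    unfolding U(2) W_def by (simp only: matrix_mul_assoc)
  moreover have "adj V ** P ** U = (adj V ** V) ** diag e ** W"
    unfolding V(2) W_def by (simp only: matrix_mul_assoc)
  ultimately have eq: "W ** diag d = diag e ** W"
    using un by simp
  have "W $ i $ j * complex_of_real (d j powr a) = complex_of_real (e i powr a) * W $ i $ j" for i j
  proof -
    have "W $ i $ j * complex_of_real (d j) = complex_of_real (e i) * W $ i $ j"
      using arg_cong [OF eq, of "\<lambda>X. X $ i $ j"] by (simp add: diag_mult_left diag_mult_right)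
    then have "W $ i $ j = 0 \<or> d j = e i" by auto
    then show ?thesis by auto
  qed
  then have eq': "W ** diag (\<lambda>i. d i powr a) = diag (\<lambda>i. e i powr a) ** W"
    by (simp add: vec_eq_iff diag_mult_left diag_mult_right)
  have "M = (V ** adj V) ** U ** diag (\<lambda>i. d i powr a) ** adj U"
    using U(3) un by simp
  also have "\<dots> = V ** (W ** diag (\<lambda>i. d i powr a)) ** adj U"
    unfolding W_def by (simp only: matrix_mul_assoc)
  also have "\<dots> = V ** (diag (\<lambda>i. e i powr a) ** W) ** adj U"
    by (simp only: eq')
  also have "\<dots> = V ** diag (\<lambda>i. e i powr a) ** adj V ** (U ** adj U)"
    unfolding W_def by (simp only: matrix_mul_assoc)
  also have "\<dots> = N"
    using V(3) un by simp
  finally show ?thesis .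
qed

definition mat_powr :: "complex^'n^'n \<Rightarrow> real \<Rightarrow> complex^'n^'n" where
  "mat_powr P a = (THE M. is_mat_powr P a M)"

lemma mat_powr_eqI: "is_mat_powr P a M \<Longrightarrow> mat_powr P a = M"
  unfolding mat_powr_def by (rule the_equality) (auto intro: is_mat_powr_unique)

definition mat_abs :: "complex^'n^'n \<Rightarrow> complex^'n^'n" where
  "mat_abs A = mat_powr (adj A ** A) (1/2)"

text \<open>
  Traces of powers of \<open>|A|\<close> are nonnegative reals; \<open>Re\<close> only converts the type.
\<close>

definition trace_dist :: "complex^'n^'n \<Rightarrow> complex^'n^'n \<Rightarrow> real" where
  "trace_dist \<rho>0 \<rho>1 = 1/2 * Re (trace (mat_abs (\<rho>0 - \<rho>1)))"

definition T_alpha :: "real \<Rightarrow> complex^'n^'n \<Rightarrow> complex^'n^'n \<Rightarrow> real" where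
  "T_alpha \<alpha> \<rho>0 \<rho>1 = 1/2 * Re (trace (mat_powr (mat_abs (\<rho>0 - \<rho>1)) \<alpha>)) powr (1/\<alpha>)"

definition Lambda_alpha :: "real \<Rightarrow> complex^'n^'n \<Rightarrow> complex^'n^'n \<Rightarrow> real" where
  "Lambda_alpha \<alpha> \<rho>0 \<rho>1 = 1/2 * Re (trace (mat_powr (mat_abs (\<rho>0 - \<rho>1)) \<alpha>))"

definition T_infty :: "complex^'n^'n \<Rightarrow> complex^'n^'n \<Rightarrow> real" where
  "T_infty \<rho>0 \<rho>1 = 1/2 * onorm ((*v) (\<rho>0 - \<rho>1))"

end

theory Submission
  imports Defs
begin

text \<open>
  Diagonalise \<open>\<rho>\<^sub>0 - \<rho>\<^sub>1\<close>. As its trace vanishes, its positive eigenvalues and the absolute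
  values of its negative eigenvalues have the same sum, namely the trace distance. The form of
  \<open>\<rho>\<^sub>0\<close> is positive on the span of the eigenvectors with positive eigenvalue, so there are at most
  \<open>rank \<rho>\<^sub>0\<close> of these, and likewise at most \<open>rank \<rho>\<^sub>1\<close> negative ones. All bounds then follow by
  applying the power mean inequalities to the positive and the negative eigenvalues separately.
\<close>

subsection \<open>Spectral decomposition of Hermitian matrices\<close>

text \<open>The eigenvector maximises the quadratic form on the unit sphere of \<open>W\<close>.\<close>

lemma selfadjoint_eigenvector_in_invariant_subspace:
  fixes f :: "'a::euclidean_space \<Rightarrow> 'a"
  assumes f: "linear f" and sym: "\<And>x y. f x \<bullet> y = x \<bullet> f y"
    and W: "subspace W" and inv: "\<And>x. x \<in> W \<Longrightarrow> f x \<in> W"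
    and w: "w \<in> W" "w \<noteq> 0"
  obtains x l where "x \<in> W" "norm x = 1" "f x = l *\<^sub>R x"
proof -
  have comp: "compact (sphere 0 1 \<inter> W)"
    by (simp add: closed_subspace W compact_Int_closed)
  have ne: "sphere 0 1 \<inter> W \<noteq> {}"
  proof -
    have "w /\<^sub>R norm w \<in> sphere 0 1 \<inter> W"
      using w W by (simp add: subspace_scale)
    then show ?thesis by blast
  qed
  have cont: "continuous_on (sphere 0 1 \<inter> W) (\<lambda>x. x \<bullet> f x)"
    using f by (intro continuous_on_inner continuous_on_id linear_continuous_on)
      (simp add: linear_conv_bounded_linear)
  obtain x where x: "x \<in> sphere 0 1 \<inter> W"
    and max: "\<And>y. y \<in> sphere 0 1 \<inter> W \<Longrightarrow> y \<bullet> f y \<le> x \<bullet> f x"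
    using continuous_attains_sup [OF comp ne cont] by auto
  define l where "l = x \<bullet> f x"
  \<comment> \<open>The residual of the eigenvalue equation. If it were nonzero, moving from
    \<open>x\<close> along \<open>- z\<close> inside \<open>W\<close> would push the form above
    \<open>l\<close> times the squared norm.\<close>
  define z where "z = l *\<^sub>R x - f x"
  have Q: "y \<bullet> f y \<le> l * (y \<bullet> y)" if "y \<in> W" for y
  proof (cases "y = 0")
    case False
    have "(y /\<^sub>R norm y) \<bullet> f (y /\<^sub>R norm y) \<le> l"
      unfolding l_def using that False W by (intro max) (simp add: subspace_scale)
    then have "(y \<bullet> f y) / (norm y)\<^sup>2 \<le> l"
      using f by (simp add: linear_scale power2_eq_square field_simps)
    then show ?thesis
      using False by (simp add: field_simps power2_norm_eq_inner)
  qed (simp add: linear_0 [OF f])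
  have zW: "z \<in> W"
    using x W inv by (auto simp: z_def intro!: subspace_diff subspace_scale)
  have xx: "x \<bullet> x = 1"
    using x by (simp add: norm_eq_1)
  have zx: "z \<bullet> z = l * (x \<bullet> z) - f x \<bullet> z"
    by (simp add: z_def inner_diff_left)
  \<comment> \<open>In the bound \<open>Q\<close> at \<open>x - t *\<^sub>R z\<close> the constant
    terms cancel and the first-order terms combine to \<open>2 * t * (z \<bullet> z)\<close>. After
    division by \<open>t\<close>, the limit as \<open>t\<close> tends to \<open>0\<close> from the
    right forces \<open>z = 0\<close>.\<close>
  have key: "2 * (z \<bullet> z) \<le> t * (l * (z \<bullet> z) - z \<bullet> f z)" if "t > 0" for t
  proof -
    have "(x - t *\<^sub>R z) \<bullet> f (x - t *\<^sub>R z) \<le> l * ((x - t *\<^sub>R z) \<bullet> (x - t *\<^sub>R z))"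
      using x W zW by (intro Q) (auto intro!: subspace_diff subspace_scale)
    also have "(x - t *\<^sub>R z) \<bullet> f (x - t *\<^sub>R z) = l - 2 * t * (f x \<bullet> z) + t\<^sup>2 * (z \<bullet> f z)"
      using sym[of x z] by (simp add: linear_diff[OF f] linear_scale[OF f] inner_diff_left inner_diff_right
          l_def algebra_simps power2_eq_square inner_commute)
    also have "(x - t *\<^sub>R z) \<bullet> (x - t *\<^sub>R z) = 1 - 2 * t * (x \<bullet> z) + t\<^sup>2 * (z \<bullet> z)"
      using xx by (simp add: inner_diff_left inner_diff_right algebra_simps power2_eq_square inner_commute)
    finally have "t * (2 * (l * (x \<bullet> z) - f x \<bullet> z)) \<le> t * (t * (l * (z \<bullet> z) - z \<bullet> f z))"
      by (simp add: algebra_simps power2_eq_square)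
    then have "t * (2 * (z \<bullet> z)) \<le> t * (t * (l * (z \<bullet> z) - z \<bullet> f z))"
      by (simp only: zx)
    then show ?thesis using that by simp
  qed
  have "2 * (z \<bullet> z) \<le> 0"
  proof (rule tendsto_lowerbound)
    show "((\<lambda>t. t * (l * (z \<bullet> z) - z \<bullet> f z)) \<longlongrightarrow> 0) (at_right 0)"
      by (intro tendsto_mult_left_zero) (rule tendsto_ident_at)
    show "\<forall>\<^sub>F t in at_right 0. 2 * (z \<bullet> z) \<le> t * (l * (z \<bullet> z) - z \<bullet> f z)"
      using key by (simp add: eventually_at_filter)
  qed simp
  then have "z = 0"
    using inner_ge_zero[of z] by (metis inner_eq_zero_iff mult_le_0_iff nle_le not_numeral_le_zero)
  then show thesis
    using that[of x l] x by (simp add: z_def)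
qed

text \<open>The Hermitian form behind \<open>psd\<close>, conjugate-linear in its first argument.
  Its real part is the Euclidean inner product of the type, which lets real arguments be applied to
  it.\<close>

definition cinner :: "complex^'n \<Rightarrow> complex^'n \<Rightarrow> complex" where
  "cinner x y = (\<Sum>i\<in>UNIV. cnj (x $ i) * y $ i)"

lemma Re_cinner: "Re (cinner x y) = x \<bullet> y"
  by (simp add: cinner_def inner_vec_def inner_complex_def)

lemma cnj_cinner: "cnj (cinner x y) = cinner y x"
  by (simp add: cinner_def mult.commute)

lemma cinner_smult_left: "cinner (c *s x) y = cnj c * cinner x y"
  by (simp add: cinner_def sum_distrib_left mult_ac)

lemma cinner_self: "cinner x x = complex_of_real ((norm x)\<^sup>2)"
proof (rule complex_eqI)
  have "Im (cinner x x) = 0"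
    using arg_cong[OF cnj_cinner[of x x], of Im] by simp
  then show "Im (cinner x x) = Im (complex_of_real ((norm x)\<^sup>2))" by simp
qed (simp add: Re_cinner power2_norm_eq_inner)

lemma cinner_adj: "cinner (A *v x) y = cinner x (adj A *v y)"
  unfolding cinner_def matrix_vector_mult_def adj_def
  by (simp add: sum_distrib_left sum_distrib_right mult_ac) (rule sum.swap)

text \<open>The real part of \<open>cinner (\<i> *s x) y\<close> is the imaginary part of
  \<open>cinner x y\<close>. One complex orthogonality condition thus becomes two real ones.\<close>

lemma cinner_eq_0_iff: "cinner x y = 0 \<longleftrightarrow> x \<bullet> y = 0 \<and> (\<i> *s x) \<bullet> y = 0"
  by (simp add: complex_eq_iff Re_cinner [symmetric] cinner_smult_left)

lemma scaleR_eq_smult: "r *\<^sub>R (x :: complex^'n) = complex_of_real r *s x"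
  by (simp add: vec_eq_iff scaleR_conv_of_real [where 'a=complex])

text \<open>Induction on the set of labels: the complex orthogonal complement of the eigenvectors
  found so far is invariant because \<open>A\<close> is Hermitian, and nonzero by dimension, so it
  contains a further unit eigenvector.\<close>

lemma hermitian_orthonormal_eigenvectors:
  fixes A :: "complex^'n^'n"
  assumes A: "adj A = A" and I: "finite (I :: 'n set)"
  shows "\<exists>v l. (\<forall>i\<in>I. A *v v i = complex_of_real (l i) *s v i) \<and>
               (\<forall>i\<in>I. \<forall>j\<in>I. cinner (v i) (v j) = (if i = j then 1 else 0))"
  using I
proof (induction I rule: finite_induct)
  case (insert k I)
  then obtain v l where v: "\<And>i. i \<in> I \<Longrightarrow> A *v v i = complex_of_real (l i) *s v i"
    and on: "\<And>i j. i \<in> I \<Longrightarrow> j \<in> I \<Longrightarrow> cinner (v i) (v j) = (if i = j then 1 else 0)"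
    by blast
  define W where "W = {x. \<forall>i\<in>I. cinner (v i) x = 0}"
  \<comment> \<open>Real orthogonality to \<open>S\<close> is complex orthogonality to all
    \<open>v i\<close>. The real dimension of its span is at most \<open>2 * card I\<close>, below
    the real dimension \<open>2 * CARD('n)\<close> of the whole space.\<close>
  define S where "S = v ` I \<union> (\<lambda>i. \<i> *s v i) ` I"
  have "finite S"
    using insert by (simp add: S_def)
  have "card S \<le> card I + card I"
    unfolding S_def using insert
    by (intro order_trans[OF card_Un_le] add_mono card_image_le) auto
  moreover have "card I < CARD('n)"
    using insert.hyps by (intro psubset_card_mono) auto
  ultimately have "dim S < DIM(complex^'n)"
    using dim_le_card'[OF \<open>finite S\<close>] by simp
  then obtain w where w: "w \<noteq> 0" "\<And>y. y \<in> span S \<Longrightarrow> orthogonal w y"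
    using orthogonal_to_subspace_exists by blast
  have "w \<in> W"
    using w(2) [unfolded orthogonal_def inner_commute [of w], OF span_base]
    by (auto simp: W_def cinner_eq_0_iff S_def)
  have "subspace W"
    unfolding W_def subspace_def cinner_eq_0_iff by (auto simp: inner_add_right)
  have inv: "A *v x \<in> W" if "x \<in> W" for x
    unfolding W_def
  proof (intro CollectI ballI)
    fix i assume i: "i \<in> I"
    have "cinner (v i) (A *v x) = cinner (A *v v i) x"
      using A by (simp add: cinner_adj)
    also have "\<dots> = 0"
      using that i by (simp add: v cinner_smult_left W_def)
    finally show "cinner (v i) (A *v x) = 0" .
  qed
  have sym: "(A *v x) \<bullet> y = x \<bullet> (A *v y)" for x y
    using A by (simp add: Re_cinner [symmetric] cinner_adj)
  have "linear ((*v) A)"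
    by (simp add: matrix_vector_mul_bounded_linear bounded_linear.linear)
  then obtain x m where x: "x \<in> W" "norm x = 1" "A *v x = m *\<^sub>R x"
    using selfadjoint_eigenvector_in_invariant_subspace[OF _ sym \<open>subspace W\<close> inv \<open>w \<in> W\<close> w(1)]
    by blast
  have "cinner (v i) x = 0" "cinner x (v i) = 0" if "i \<in> I" for i
    using x(1) that cnj_cinner[of "v i" x] by (auto simp: W_def)
  moreover have "cinner x x = 1"
    using x(2) by (simp add: cinner_self)
  ultimately show ?case
    using insert.hyps v on x(3)
    by (intro exI[of _ "v(k := x)"] exI[of _ "l(k := m)"]) (auto simp: scaleR_eq_smult)
qed simp

text \<open>The eigenvectors become the columns of \<open>U\<close>, so that orthonormality reads
  \<open>adj U ** U = mat 1\<close>.\<close>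

lemma hermitian_spectral:
  fixes A :: "complex^'n^'n"
  assumes "adj A = A"
  obtains U l where "unitary U" "A = U ** diag l ** adj U"
proof -
  obtain v :: "'n \<Rightarrow> complex^'n" and l
    where v: "\<And>i. A *v v i = complex_of_real (l i) *s v i"
    and on: "\<And>i j. cinner (v i) (v j) = (if i = j then 1 else 0)"
    using hermitian_orthonormal_eigenvectors[OF assms finite_class.finite_UNIV] by (metis UNIV_I)
  define U :: "complex^'n^'n" where "U = (\<chi> i j. v j $ i)"
  have "adj U ** U = mat 1"
    using on by (simp add: vec_eq_iff matrix_matrix_mult_def adj_def U_def mat_def cinner_def)
  then have U: "unitary U"
    using matrix_left_right_inverse unfolding unitary_def by blast
  have "A ** U = U ** diag l"
    unfolding vec_eq_iff diag_mult_right
    using v by (auto simp: vec_eq_iff matrix_matrix_mult_def matrix_vector_mult_def U_def mult.commute)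
  then have "A ** (U ** adj U) = U ** diag l ** adj U"
    by (simp add: matrix_mul_assoc)
  then show thesis
    using that U by (simp add: unitary_def)
qed


subsection \<open>Functional calculus, operator norm and rank\<close>

lemma adj_mult: "adj (A ** B) = adj B ** adj A"
  by (simp add: adj_def matrix_matrix_mult_def vec_eq_iff mult.commute)

lemma adj_adj [simp]: "adj (adj A) = A"
  by (simp add: adj_def vec_eq_iff)

lemma adj_diag [simp]: "adj (diag l) = diag l"
  by (simp add: adj_def diag_def vec_eq_iff)

lemma adj_diff: "adj (A - B) = adj A - adj B"
  by (simp add: adj_def vec_eq_iff)

lemma diag_mult_diag: "diag l ** diag m = diag (\<lambda>i. l i * m i)"
  by (simp add: vec_eq_iff diag_mult_left) (simp add: diag_def)

lemma diag_vector_mult: "(diag l *v x) $ i = complex_of_real (l i) * x $ i"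
  by (simp add: diag_def matrix_vector_mult_def if_distrib [where f = "\<lambda>x. x * _"] cong: if_cong)

lemma trace_unitary_conjugate:
  assumes "unitary U"
  shows "trace (U ** B ** adj U) = trace B"
proof -
  have "trace (U ** B ** adj U) = trace (adj U ** (U ** B))"
    by (rule trace_mul_sym)
  then show ?thesis
    using assms by (simp add: matrix_mul_assoc unitary_def)
qed

lemma trace_diag: "trace (diag l) = complex_of_real (\<Sum>i\<in>UNIV. l i)"
  by (simp add: trace_def diag_def)

lemma mat_powr_spectral:
  assumes "unitary U" "\<And>i. 0 \<le> l i"
  shows "mat_powr (U ** diag l ** adj U) a = U ** diag (\<lambda>i. l i powr a) ** adj U"
  using assms by (intro mat_powr_eqI) (auto simp: is_mat_powr_def)

text \<open>Squaring the eigenvalues and taking the nonnegative root turns \<open>l i\<close> into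
  its absolute value.\<close>

lemma mat_abs_spectral:
  assumes U: "unitary U"
  shows "mat_abs (U ** diag l ** adj U) = U ** diag (\<lambda>i. \<bar>l i\<bar>) ** adj U"
proof -
  have "adj (U ** diag l ** adj U) ** (U ** diag l ** adj U)
      = U ** diag l ** (adj U ** U) ** diag l ** adj U"
    by (simp add: adj_mult matrix_mul_assoc)
  also have "\<dots> = U ** (diag l ** diag l) ** adj U"
    using U by (simp add: unitary_def matrix_mul_assoc)
  also have "\<dots> = U ** diag (\<lambda>i. l i * l i) ** adj U"
    by (simp only: diag_mult_diag)
  finally show ?thesis
    by (simp add: mat_abs_def mat_powr_spectral [OF U] powr_half_sqrt)
qed

lemma norm_unitary_mult:
  assumes "unitary U"
  shows "norm (U *v x) = norm x"
proof -
  have "cinner (U *v x) (U *v x) = cinner x x"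
    using assms by (simp add: cinner_adj matrix_vector_mul_assoc unitary_def)
  then have "(norm (U *v x))\<^sup>2 = (norm x)\<^sup>2"
    unfolding cinner_self of_real_eq_iff .
  then show ?thesis by simp
qed

lemma unitary_adj: "unitary U \<Longrightarrow> unitary (adj U)"
  by (simp add: unitary_def)

text \<open>Unitary factors preserve the norm, and \<open>diag l\<close> is dominated componentwise
  by scaling with \<open>m\<close>.\<close>

lemma onorm_spectral_le:
  fixes U :: "complex^'n^'n"
  assumes U: "unitary U" and m: "\<And>i. \<bar>l i\<bar> \<le> m"
  shows "onorm ((*v) (U ** diag l ** adj U)) \<le> m"
proof (rule onorm_le)
  fix x
  define y where "y = adj U *v x"
  \<comment> \<open>An index type is never empty, so any index yields
    \<open>0 \<le> m\<close>.\<close>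
  have m0: "0 \<le> m" using m[of undefined] by linarith
  have "norm ((U ** diag l ** adj U) *v x) = norm (diag l *v y)"
    by (simp add: y_def norm_unitary_mult [OF U] flip: matrix_vector_mul_assoc)
  also have "\<dots> \<le> norm (m *\<^sub>R y)"
  proof (rule norm_le_componentwise_cart)
    show "norm ((diag l *v y) $ i) \<le> norm ((m *\<^sub>R y) $ i)" for i
      using m[of i] m0 by (simp add: diag_vector_mult norm_mult mult_right_mono)
  qed
  also have "\<dots> = m * norm x"
    using m0 by (simp add: y_def norm_unitary_mult [OF unitary_adj [OF U]])
  finally show "norm ((U ** diag l ** adj U) *v x) \<le> m * norm x" .
qed

text \<open>The operator is tested on column \<open>i\<close> of \<open>U\<close>, a unit
  eigenvector for \<open>l i\<close>.\<close>

lemma abs_eigenvalue_le_onorm: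
  fixes U :: "complex^'n^'n"
  assumes U: "unitary U"
  shows "\<bar>l i\<bar> \<le> onorm ((*v) (U ** diag l ** adj U))"
proof -
  let ?A = "U ** diag l ** adj U" and ?e = "axis i 1 :: complex^'n"
  have "?A *v (U *v ?e) = U *v (diag l *v ((adj U ** U) *v ?e))"
    by (simp add: matrix_vector_mul_assoc matrix_mul_assoc)
  also have "\<dots> = U *v (diag l *v ?e)"
    using U by (simp add: unitary_def)
  also have "diag l *v ?e = l i *\<^sub>R ?e"
    by (simp add: vec_eq_iff diag_vector_mult axis_def of_real_def)
  finally have "norm (?A *v (U *v ?e)) = \<bar>l i\<bar>"
    by (simp add: norm_unitary_mult [OF U] norm_axis_1)
  moreover have "norm (?A *v (U *v ?e)) \<le> onorm ((*v) ?A) * norm (U *v ?e)"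
    by (rule onorm) (rule matrix_vector_mul_bounded_linear)
  ultimately show ?thesis
    by (simp add: norm_unitary_mult [OF U] norm_axis_1)
qed

text \<open>
  On the span of the eigenvectors of \<open>R - S\<close> with positive eigenvalues the form of \<open>R\<close> is
  positive definite, so \<open>R\<close> is injective there. Since \<^const>\<open>rank\<close> is the row rank, the argument
  uses the complex conjugate of \<open>R\<close>, which for Hermitian \<open>R\<close> is its transpose.
\<close>

lemma card_positive_eigenvalues_le_rank:
  fixes R S U :: "complex^'n^'n"
  assumes R: "psd R" and S: "psd S" and U: "unitary U" and eq: "R - S = U ** diag l ** adj U"
  shows "card {i. 0 < l i} \<le> rank R"
proof -
  define P where "P = {i. 0 < l i}"
  define cv :: "complex^'n \<Rightarrow> complex^'n" where "cv x = (\<chi> i. cnj (x $ i))" for x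
  \<comment> \<open>For Hermitian \<open>R\<close> this is the entrywise conjugate of
    \<open>R ** U\<close>, written so that its range visibly lies in the row space of
    \<open>R\<close>.\<close>
  define V where "V = transpose R ** (\<chi> i j. cnj (U $ i $ j))"
  define E where "E = (\<lambda>i. axis i 1 :: complex^'n) ` P"
  \<comment> \<open>With \<open>x = U *v c\<close> and \<open>R *v x = 0\<close>, the form of
    \<open>R - S\<close> at \<open>x\<close> is at most \<open>0\<close> because \<open>S\<close> is
    positive. It also equals a sum of nonnegative terms \<open>l i * (cmod (c $ i))\<^sup>2\<close>,
    so all of them vanish, and \<open>l i > 0\<close> on \<open>P\<close> gives
    \<open>c = 0\<close>.\<close>
  have ker: "c = 0" if c: "\<And>i. i \<notin> P \<Longrightarrow> c $ i = 0" and 0: "R *v (U *v c) = 0" for c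
  proof -
    define x where "x = U *v c"
    have "adj U ** (R - S) ** U = (adj U ** U) ** diag l ** (adj U ** U)"
      unfolding eq by (simp only: matrix_mul_assoc)
    then have "adj U ** (R - S) ** U = diag l"
      using U by (simp add: unitary_def)
    moreover have "cinner x ((R - S) *v x) = cinner c ((adj U ** (R - S) ** U) *v c)"
      by (simp add: x_def cinner_adj matrix_vector_mul_assoc matrix_mul_assoc)
    moreover have "Re (cinner c (diag l *v c)) = (\<Sum>i\<in>UNIV. l i * (cmod (c $ i))\<^sup>2)"
      by (simp add: cinner_def diag_vector_mult cmod_power2) (simp add: power2_eq_square algebra_simps)
    ultimately have "Re (cinner x ((R - S) *v x)) = (\<Sum>i\<in>UNIV. l i * (cmod (c $ i))\<^sup>2)"
      by simp
    moreover have "Re (cinner x ((R - S) *v x)) \<le> 0"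
      using S 0 unfolding psd_def cinner_def [symmetric]
      by (simp add: x_def matrix_vector_mult_diff_rdistrib Re_cinner)
    moreover have nonneg: "0 \<le> l i * (cmod (c $ i))\<^sup>2" for i
      using c[of i] by (cases "i \<in> P") (auto simp: P_def)
    ultimately have "(\<Sum>i\<in>UNIV. l i * (cmod (c $ i))\<^sup>2) = 0"
      by (simp add: sum_nonneg order_antisym)
    then have zero: "l i * (cmod (c $ i))\<^sup>2 = 0" for i
      using nonneg by (simp add: sum_nonneg_eq_0_iff)
    have "c $ i = 0" for i
      using c[of i] zero[of i] by (cases "i \<in> P") (auto simp: P_def)
    then show "c = 0"
      by (simp add: vec_eq_iff)
  qed
  have "transpose (adj R) = (\<chi> i j. cnj (R $ i $ j))"
    by (simp add: adj_def transpose_def)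
  then have tR: "transpose R = (\<chi> i j. cnj (R $ i $ j))"
    using R by (simp only: psd_def)
  have V: "V *v c = cv (R *v (U *v cv c))" for c
    unfolding V_def tR matrix_vector_mul_assoc [symmetric]
    by (simp add: vec_eq_iff cv_def matrix_vector_mult_def)
  have supp: "x $ i = 0" if "x \<in> vec.span E" "i \<notin> P" for x i
  proof -
    have "vec.span E \<subseteq> {x. x $ i = 0}"
      using that(2) by (intro vec.span_minimal) (auto simp: E_def axis_def vec.subspace_def)
    then show ?thesis using that(1) by blast
  qed
  have "inj_on ((*v) V) (vec.span E)"
    unfolding vec.inj_on_iff_eq_0 [OF vec.subspace_span]
  proof (intro ballI impI)
    fix x assume x: "x \<in> vec.span E" "V *v x = 0"
    have "cv x = 0"
    proof (rule ker)
      show "cv x $ i = 0" if "i \<notin> P" for i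
        using supp[OF x(1) that] by (simp add: cv_def)
      show "R *v (U *v cv x) = 0"
        using x(2) by (simp add: V) (simp add: cv_def vec_eq_iff)
    qed
    then show "x = 0"
      by (simp add: cv_def vec_eq_iff)
  qed
  then have "vec.dim ((*v) V ` E) = vec.dim E"
    by (intro vec.dim_image_eq) auto
  also have "\<dots> = card E"
    by (intro vec.dim_eq_card_independent vec.independent_mono [OF vec.independent_Basis])
      (auto simp: E_def cart_basis_def)
  also have "\<dots> = card P"
    unfolding E_def by (intro card_image) (auto simp: inj_on_def axis_eq_axis)
  finally have "card P = vec.dim ((*v) V ` E)" ..
  also have "\<dots> \<le> vec.dim (rows R)"
  proof (rule vec.dim_mono)
    show "(*v) V ` E \<subseteq> vec.span (rows R)"
      using matrix_vector_mult_in_columnspace_gen [of "transpose R"]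
      by (auto simp: V_def columns_transpose simp flip: matrix_vector_mul_assoc)
  qed
  finally show ?thesis
    by (simp add: P_def row_rank_def_gen)
qed

subsection \<open>Power mean inequalities\<close>

text \<open>Each term is at most \<open>x i * s powr (a - 1)\<close>, where \<open>s\<close> is the
  whole sum; adding these bounds gives \<open>s powr a\<close>.\<close>

lemma sum_powr_le_powr_sum:
  fixes x :: "'a \<Rightarrow> real"
  assumes x: "\<And>i. i \<in> S \<Longrightarrow> 0 \<le> x i" and S: "finite S" and a: "1 \<le> a"
  shows "(\<Sum>i\<in>S. x i powr a) \<le> (\<Sum>i\<in>S. x i) powr a"
proof -
  define s where "s = sum x S"
  have s: "0 \<le> s" unfolding s_def using x by (rule sum_nonneg)
  have "x i powr a \<le> x i * s powr (a - 1)" if "i \<in> S" for i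
  proof -
    have "x i powr a = x i * x i powr (a - 1)"
      using x[OF that] by (cases "x i = 0") (auto simp: powr_diff)
    moreover have "x i \<le> s"
      unfolding s_def using that x S by (intro member_le_sum) auto
    ultimately show ?thesis
      using x[OF that] a by (simp add: mult_left_mono powr_mono2)
  qed
  then have "(\<Sum>i\<in>S. x i powr a) \<le> (\<Sum>i\<in>S. x i * s powr (a - 1))"
    by (rule sum_mono)
  also have "\<dots> = s * s powr (a - 1)"
    by (simp add: s_def sum_distrib_right)
  also have "\<dots> = s powr a"
    using s by (cases "s = 0") (auto simp: powr_diff)
  finally show ?thesis by (simp add: s_def)
qed

text \<open>Bernoulli's inequality: a convex power lies above its tangent at \<open>1\<close>. It
  follows from Young's inequality for \<open>t powr a\<close> and \<open>1\<close> with weights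
  \<open>1 / a\<close> and \<open>1 - 1 / a\<close>.\<close>

lemma powr_ge_tangent:
  fixes t :: real
  assumes "0 \<le> t" "1 \<le> a"
  shows "1 + a * (t - 1) \<le> t powr a"
proof (cases "t = 0")
  case False
  have "(t powr a) powr (1 / a) * 1 powr (1 - 1 / a) \<le> 1 / a * t powr a + (1 - 1 / a) * 1"
    using assms False by (intro Youngs_inequality_0) auto
  then have "a * t \<le> a * (1 / a * t powr a + (1 - 1 / a) * 1)"
    using assms False by (intro mult_left_mono) (auto simp: powr_powr)
  then show ?thesis
    using assms(2) by (simp add: algebra_simps)
qed (use assms in auto)

text \<open>Jensen's inequality for a convex power, obtained by adding the tangent bounds at the
  values divided by their mean \<open>s / k\<close>.\<close>

lemma card_powr_sum_le_sum_powr: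
  fixes x :: "'a \<Rightarrow> real"
  assumes x: "\<And>i. i \<in> S \<Longrightarrow> 0 \<le> x i" and S: "finite S" and a: "1 \<le> a"
  shows "real (card S) powr (1 - a) * (\<Sum>i\<in>S. x i) powr a \<le> (\<Sum>i\<in>S. x i powr a)"
proof (cases "sum x S = 0")
  case False
  define s where "s = sum x S"
  define k where "k = real (card S)"
  have "0 \<le> s" unfolding s_def using x by (rule sum_nonneg)
  then have s: "0 < s" using False by (simp add: s_def)
  have k: "0 < k"
    using False S by (auto simp: k_def card_gt_0_iff)
  \<comment> \<open>The normalised values have mean \<open>1\<close>, so the linear terms
    cancel.\<close>
  have "k = (\<Sum>i\<in>S. 1 + a * (x i / (s / k) - 1))"
  proof -
    have "(\<Sum>i\<in>S. x i / (s / k)) = k"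
      using s k by (simp add: s_def [symmetric] flip: sum_divide_distrib sum_distrib_right)
    then show ?thesis
      by (simp add: sum.distrib sum_subtractf k_def flip: sum_distrib_left)
  qed
  also have "\<dots> \<le> (\<Sum>i\<in>S. (x i / (s / k)) powr a)"
    using x s k a by (intro sum_mono powr_ge_tangent) auto
  also have "\<dots> = (\<Sum>i\<in>S. x i powr a) / (s / k) powr a"
    unfolding sum_divide_distrib using x s k by (intro sum.cong refl powr_divide)
  finally have "k * (s / k) powr a \<le> (\<Sum>i\<in>S. x i powr a)"
    using s k by (simp add: field_simps)
  moreover have "k * (s / k) powr a = k powr (1 - a) * s powr a"
    using s k by (simp add: powr_divide powr_diff)
  ultimately show ?thesis by (simp add: s_def k_def)
qed (simp add: sum_nonneg)

text \<open>This is the convex case with exponent \<open>1 / a\<close> applied to the numbers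
  \<open>x i powr a\<close>.\<close>

lemma powr_sum_le_sum_powr_concave:
  fixes x :: "'a \<Rightarrow> real"
  assumes x: "\<And>i. i \<in> S \<Longrightarrow> 0 \<le> x i" and S: "finite S" and a: "0 < a" "a \<le> 1"
  shows "(\<Sum>i\<in>S. x i) powr a \<le> (\<Sum>i\<in>S. x i powr a)"
proof -
  have "(\<Sum>i\<in>S. (x i powr a) powr (1 / a)) \<le> (\<Sum>i\<in>S. x i powr a) powr (1 / a)"
    using S a by (intro sum_powr_le_powr_sum) auto
  then have "sum x S \<le> (\<Sum>i\<in>S. x i powr a) powr (1 / a)"
    using x a by (simp add: powr_powr)
  then have "sum x S powr a \<le> ((\<Sum>i\<in>S. x i powr a) powr (1 / a)) powr a"
    using x a by (intro powr_mono2) (auto intro: sum_nonneg)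
  then show ?thesis
    using a by (simp add: powr_powr sum_nonneg)
qed

text \<open>Again the convex case with exponent \<open>1 / a\<close> for the numbers
  \<open>x i powr a\<close>; raising it to the power \<open>a\<close> leaves a factor
  \<open>card S powr (a - 1)\<close> to be moved across.\<close>

lemma sum_powr_le_card_powr_sum_concave:
  fixes x :: "'a \<Rightarrow> real"
  assumes x: "\<And>i. i \<in> S \<Longrightarrow> 0 \<le> x i" and S: "finite S" and a: "0 < a" "a \<le> 1"
  shows "(\<Sum>i\<in>S. x i powr a) \<le> real (card S) powr (1 - a) * (\<Sum>i\<in>S. x i) powr a"
proof (cases "S = {}")
  case False
  then have k: "0 < real (card S)" using S by (simp add: card_gt_0_iff)
  define F where "F = (\<Sum>i\<in>S. x i powr a)"
  have F: "0 \<le> F" by (simp add: F_def sum_nonneg)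
  have "real (card S) powr (1 - 1 / a) * F powr (1 / a) \<le> (\<Sum>i\<in>S. (x i powr a) powr (1 / a))"
    unfolding F_def using S a by (intro card_powr_sum_le_sum_powr) auto
  also have "\<dots> = sum x S"
    using x a by (simp add: powr_powr)
  finally have "(real (card S) powr (1 - 1 / a) * F powr (1 / a)) powr a \<le> sum x S powr a"
    using a by (intro powr_mono2) auto
  moreover have "(real (card S) powr (1 - 1 / a) * F powr (1 / a)) powr a = real (card S) powr (a - 1) * F"
    using a F by (simp add: powr_mult powr_powr left_diff_distrib)
  moreover have "real (card S) powr (1 - a) * real (card S) powr (a - 1) = 1"
    using k by (simp flip: powr_add)
  ultimately show ?thesis
    unfolding F_def [symmetric]
    by (metis (no_types, lifting) mult.assoc mult.left_neutral mult_left_mono powr_ge_zero)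
qed simp

subsection \<open>Trace distance and Schatten distances\<close>

theorem theorem1p3:
  fixes \<rho>0 \<rho>1 :: "complex^'n^'n"
  assumes "quantum_state \<rho>0" and "quantum_state \<rho>1"
  shows
    "(\<forall>\<alpha>::real. 1 \<le> \<alpha> \<longrightarrow>
        2 powr (1 - 1/\<alpha>) * T_alpha \<alpha> \<rho>0 \<rho>1 \<le> trace_dist \<rho>0 \<rho>1 \<and>
        trace_dist \<rho>0 \<rho>1
          \<le> 2 * (real (rank \<rho>0) powr (1 - \<alpha>) + real (rank \<rho>1) powr (1 - \<alpha>)) powr (- (1/\<alpha>))
              * T_alpha \<alpha> \<rho>0 \<rho>1) \<and>
     (2 * T_infty \<rho>0 \<rho>1 \<le> trace_dist \<rho>0 \<rho>1 \<and>
      trace_dist \<rho>0 \<rho>1 \<le> 2 * real (min (rank \<rho>0) (rank \<rho>1)) * T_infty \<rho>0 \<rho>1) \<and>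
     (\<forall>\<alpha>::real. 0 < \<alpha> \<and> \<alpha> < 1 \<longrightarrow>
        trace_dist \<rho>0 \<rho>1 powr \<alpha> \<le> Lambda_alpha \<alpha> \<rho>0 \<rho>1 \<and>
        Lambda_alpha \<alpha> \<rho>0 \<rho>1
          \<le> (real (rank \<rho>0) powr (1 - \<alpha>) + real (rank \<rho>1) powr (1 - \<alpha>)) / 2
              * trace_dist \<rho>0 \<rho>1 powr \<alpha>)"
proof -
  have psd: "psd \<rho>0" "psd \<rho>1" and tr: "trace \<rho>0 = 1" "trace \<rho>1 = 1"
    using assms by (auto simp: quantum_state_def)
  have "adj (\<rho>0 - \<rho>1) = \<rho>0 - \<rho>1"
    using psd by (simp add: psd_def adj_diff)
  then obtain U l where U: "unitary U" and A: "\<rho>0 - \<rho>1 = U ** diag l ** adj U"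
    using hermitian_spectral by blast
  define P where "P = {i. 0 < l i}"
  define N where "N = {i. l i < 0}"
  define s where "s = (\<Sum>i\<in>P. l i)"
  define F where "F a = (\<Sum>i\<in>UNIV. \<bar>l i\<bar> powr a)" for a
  \<comment> \<open>Zero eigenvalues drop out because \<open>g 0 = 0\<close>; for powers this rests
    on \<open>0 powr a = 0\<close>.\<close>
  have split: "(\<Sum>i\<in>UNIV. g (l i)) = (\<Sum>i\<in>P. g (l i)) + (\<Sum>i\<in>N. g (l i))"
    if "g 0 = 0" for g :: "real \<Rightarrow> real"
  proof -
    have "(\<Sum>i\<in>UNIV. g (l i)) = (\<Sum>i\<in>P \<union> N. g (l i))"
      using that by (intro sum.mono_neutral_right) (auto simp: P_def N_def not_less intro: order_antisym)
    also have "\<dots> = (\<Sum>i\<in>P. g (l i)) + (\<Sum>i\<in>N. g (l i))"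
      by (rule sum.union_disjoint) (auto simp: P_def N_def)
    finally show ?thesis .
  qed
  have "complex_of_real (\<Sum>i\<in>UNIV. l i) = trace (\<rho>0 - \<rho>1)"
    by (simp only: A trace_unitary_conjugate [OF U] trace_diag)
  also have "\<dots> = 0"
    using tr by (simp add: trace_sub)
  finally have "(\<Sum>i\<in>UNIV. l i) = 0"
    by (simp only: of_real_eq_0_iff)
  then have sN: "(\<Sum>i\<in>N. - l i) = s"
    using split [of "\<lambda>x. x"] by (simp add: s_def sum_negf)
  have F_split: "F a = (\<Sum>i\<in>P. l i powr a) + (\<Sum>i\<in>N. (- l i) powr a)" for a
    using split [of "\<lambda>x. \<bar>x\<bar> powr a"] by (simp add: F_def P_def N_def)
  have abs: "mat_abs (\<rho>0 - \<rho>1) = U ** diag (\<lambda>i. \<bar>l i\<bar>) ** adj U"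
    by (simp only: A mat_abs_spectral [OF U])
  have "(\<Sum>i\<in>UNIV. \<bar>l i\<bar>) = 2 * s"
    using split [of abs] sN by (simp add: s_def P_def N_def)
  then have dist: "trace_dist \<rho>0 \<rho>1 = s"
    by (simp add: trace_dist_def abs trace_unitary_conjugate [OF U] trace_diag flip: of_real_sum)
  have Lam: "Lambda_alpha a \<rho>0 \<rho>1 = F a / 2" and Tal: "T_alpha a \<rho>0 \<rho>1 = F a powr (1/a) / 2" for a
    by (simp_all add: Lambda_alpha_def T_alpha_def abs mat_powr_spectral [OF U]
        trace_unitary_conjugate [OF U] trace_diag F_def flip: of_real_sum)
  define o' where "o' = onorm ((*v) (\<rho>0 - \<rho>1))"
  have Tinf: "T_infty \<rho>0 \<rho>1 = o' / 2"
    by (simp add: T_infty_def o'_def)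
  have pos: "\<And>i. i \<in> P \<Longrightarrow> 0 \<le> l i" "\<And>i. i \<in> N \<Longrightarrow> 0 \<le> - l i"
    by (auto simp: P_def N_def)
  have s0: "0 \<le> s" unfolding s_def using pos by (intro sum_nonneg)
  have F0: "0 \<le> F a" for a by (simp add: F_def sum_nonneg)
  have rP: "card P \<le> rank \<rho>0"
    unfolding P_def by (rule card_positive_eigenvalues_le_rank [OF psd U A])
  \<comment> \<open>Exchanging the states negates the eigenvalues, so the rank bound for positive
    eigenvalues also covers \<open>N\<close>.\<close>
  have "\<rho>1 - \<rho>0 = - (\<rho>0 - \<rho>1)" by simp
  also have "\<dots> = U ** diag (\<lambda>i. - l i) ** adj U"
    unfolding A by (simp add: vec_eq_iff matrix_matrix_mult_def [of _ "adj U"] diag_mult_right sum_negf)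
  finally have rN: "card N \<le> rank \<rho>1"
    using card_positive_eigenvalues_le_rank [OF psd(2,1) U, of "\<lambda>i. - l i"] by (simp add: N_def)
  have ne: "0 < card P" "0 < card N" if "0 < s"
    using that sN by (auto simp: s_def card_gt_0_iff)
  have o_ge: "\<bar>l i\<bar> \<le> o'" for i
    unfolding o'_def A by (rule abs_eigenvalue_le_onorm [OF U])
  then have o0: "0 \<le> o'"
    using abs_ge_zero order_trans by blast
  \<comment> \<open>Each \<open>\<bar>l i\<bar>\<close> is \<open>0\<close> or one nonnegative
    summand of a sum over \<open>P\<close> or \<open>N\<close>, and both sums equal
    \<open>s\<close>.\<close>
  have o_le: "o' \<le> s"
    unfolding o'_def A
  proof (rule onorm_spectral_le [OF U])
    fix i
    consider "i \<in> P" | "i \<in> N" | "l i = 0" unfolding P_def N_def using linorder_less_linear by blast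
    then show "\<bar>l i\<bar> \<le> s"
    proof cases
      case 1
      then have "l i \<le> s" unfolding s_def using pos by (intro member_le_sum) auto
      then show ?thesis using 1 pos by simp
    next
      case 2
      then have "- l i \<le> s" unfolding sN [symmetric] using pos by (intro member_le_sum) auto
      then show ?thesis using pos(2)[OF 2] by simp
    qed (use s0 in simp)
  qed
  have "s \<le> real (card P) * o'"
    unfolding s_def using o_ge by (intro sum_bounded_above) (meson abs_le_iff)
  also have "\<dots> \<le> real (rank \<rho>0) * o'"
    using rP o0 by (simp add: mult_right_mono)
  finally have s_le0: "s \<le> real (rank \<rho>0) * o'" .
  have "s \<le> real (card N) * o'"
    unfolding sN [symmetric] using o_ge by (intro sum_bounded_above) (meson abs_le_iff)
  also have "\<dots> \<le> real (rank \<rho>1) * o'"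
    using rN o0 by (simp add: mult_right_mono)
  finally have s_le1: "s \<le> real (rank \<rho>1) * o'" .
  \<comment> \<open>The case of infinite exponent comes directly from bounds on the largest
    \<open>\<bar>l i\<bar>\<close>, without passing to a limit.\<close>
  have part_inf: "2 * T_infty \<rho>0 \<rho>1 \<le> trace_dist \<rho>0 \<rho>1 \<and>
      trace_dist \<rho>0 \<rho>1 \<le> 2 * real (min (rank \<rho>0) (rank \<rho>1)) * T_infty \<rho>0 \<rho>1"
    using o_le s_le0 s_le1 by (simp add: Tinf dist min_def)
  have part1: "2 powr (1 - 1/a) * T_alpha a \<rho>0 \<rho>1 \<le> trace_dist \<rho>0 \<rho>1"
    "trace_dist \<rho>0 \<rho>1
       \<le> 2 * (real (rank \<rho>0) powr (1 - a) + real (rank \<rho>1) powr (1 - a)) powr (- (1/a))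
           * T_alpha a \<rho>0 \<rho>1" if a: "1 \<le> a" for a
  proof -
    \<comment> \<open>The positive and the negative part contribute \<open>s powr a\<close> each;
      this is the source of the factor \<open>2 powr (1/a)\<close>.\<close>
    have "F a \<le> s powr a + s powr a"
      unfolding F_split
      using sum_powr_le_powr_sum [of P l a, OF pos(1) finite a]
          sum_powr_le_powr_sum [of N "\<lambda>i. - l i" a, OF pos(2) finite a]
      by (simp add: s_def [symmetric] sN add_mono)
    then have "F a powr (1/a) \<le> (2 * s powr a) powr (1/a)"
      using a F0 by (intro powr_mono2) auto
    also have "\<dots> = 2 powr (1/a) * s"
      using a s0 by (simp add: powr_mult powr_powr)
    finally have "2 powr (1 - 1/a) * F a powr (1/a) \<le> 2 powr (1 - 1/a) * (2 powr (1/a) * s)"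
      by (intro mult_left_mono) auto
    also have "\<dots> = 2 * s"
      by (simp add: powr_diff)
    finally show "2 powr (1 - 1/a) * T_alpha a \<rho>0 \<rho>1 \<le> trace_dist \<rho>0 \<rho>1"
      by (simp add: Tal dist)
    show "trace_dist \<rho>0 \<rho>1
       \<le> 2 * (real (rank \<rho>0) powr (1 - a) + real (rank \<rho>1) powr (1 - a)) powr (- (1/a))
           * T_alpha a \<rho>0 \<rho>1"
    proof (cases "s = 0")
      case False
      with s0 have s: "0 < s" by simp
      define K where "K = real (rank \<rho>0) powr (1 - a) + real (rank \<rho>1) powr (1 - a)"
      have K: "0 < K"
        using ne[OF s] rP rN by (simp add: K_def add_pos_pos)
      \<comment> \<open>The exponent is at most \<open>0\<close>, so larger ranks give smaller
        powers. The cardinalities must be positive here because \<open>0 powr (1 - a)\<close> is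
        \<open>0\<close>.\<close>
      have "K \<le> real (card P) powr (1 - a) + real (card N) powr (1 - a)"
        unfolding K_def using ne[OF s] rP rN a by (intro add_mono powr_mono2') auto
      then have "K * s powr a \<le> (real (card P) powr (1 - a) + real (card N) powr (1 - a)) * s powr a"
        by (rule mult_right_mono) simp
      also have "\<dots> \<le> F a"
        unfolding F_split distrib_right
        using card_powr_sum_le_sum_powr [of P l a, OF pos(1) finite a]
          card_powr_sum_le_sum_powr [of N "\<lambda>i. - l i" a, OF pos(2) finite a]
        by (simp add: s_def [symmetric] sN add_mono)
      finally have "(K * s powr a) powr (1/a) \<le> F a powr (1/a)"
        using a K by (intro powr_mono2) auto
      then have "K powr (1/a) * s \<le> F a powr (1/a)"
        using a s0 K by (simp add: powr_mult powr_powr)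
      then have "s \<le> K powr (- (1/a)) * F a powr (1/a)"
        using K by (simp add: powr_minus field_simps)
      then show ?thesis
        by (simp add: K_def Tal dist)
    qed (simp add: Tal dist)
  qed
  have part2: "trace_dist \<rho>0 \<rho>1 powr a \<le> Lambda_alpha a \<rho>0 \<rho>1"
    "Lambda_alpha a \<rho>0 \<rho>1
          \<le> (real (rank \<rho>0) powr (1 - a) + real (rank \<rho>1) powr (1 - a)) / 2
              * trace_dist \<rho>0 \<rho>1 powr a" if a: "0 < a" "a < 1" for a
  proof -
    have a': "a \<le> 1" using a by simp
    \<comment> \<open>The two parts each contribute at least \<open>s powr a\<close>, which the
      factor one half in \<open>Lambda_alpha\<close> compensates.\<close>
    show "trace_dist \<rho>0 \<rho>1 powr a \<le> Lambda_alpha a \<rho>0 \<rho>1"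
      unfolding Lam dist F_split
      using powr_sum_le_sum_powr_concave [of P l a, OF pos(1) finite a(1) a']
        powr_sum_le_sum_powr_concave [of N "\<lambda>i. - l i" a, OF pos(2) finite a(1) a']
      by (simp add: s_def [symmetric] sN)
    have "F a \<le> (real (card P) powr (1 - a) + real (card N) powr (1 - a)) * s powr a"
      unfolding F_split distrib_right
      using sum_powr_le_card_powr_sum_concave [of P l a, OF pos(1) finite a(1) a']
        sum_powr_le_card_powr_sum_concave [of N "\<lambda>i. - l i" a, OF pos(2) finite a(1) a']
      by (simp add: s_def [symmetric] sN add_mono)
    \<comment> \<open>Now \<open>1 - a\<close> is positive, so the powers increase from the
      cardinalities to the ranks.\<close>
    also have "\<dots> \<le> (real (rank \<rho>0) powr (1 - a) + real (rank \<rho>1) powr (1 - a)) * s powr a"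
      using rP rN a by (intro mult_right_mono add_mono powr_mono2) auto
    finally show "Lambda_alpha a \<rho>0 \<rho>1
          \<le> (real (rank \<rho>0) powr (1 - a) + real (rank \<rho>1) powr (1 - a)) / 2
              * trace_dist \<rho>0 \<rho>1 powr a"
      by (simp add: Lam dist)
  qed
  show ?thesis
    using part1 part_inf part2 by blast
qed

end
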